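(* Let $S_+^k \subset \mathbb{R}^n$ be the (nonempty, finite) set of positive training examples in the $k$-th cluster and let $S_-^k \subset \mathbb{R}^n$ be the (finite) set of training examples not in the $k$-th cluster. Fix a coordinate $j \in \{1,\dots,n\}$, a weight $0<c<1$ and a regularization parameter $\beta \in \mathbb{R}$. For $p=1,\dots,n$ let $l_{s,p,k} = \min_{x \in S_+^k} x_p$ and $u_{s,p,k} = \max_{x\in S_+^k} x_p$. With $X_{u,j,k} \subseteq \mathbb{R}^n$ as defined in the context, put $$R_+^{u,j,k} := \sum_{x \in S_+^k \cap X_{u,j,k}} \exp\left[-(u_{s,j,k} - x_j + 1)\right],$$ $$R_-^{u,j,k} := \sum_{x \in S_-^k \cap X_{u,j,k}} \exp\Big[u_{s,j,k} - x_j + 1 + \sum_{p \neq j}\big(\lfloor x_p - u_{s,p,k}\rfloor_+ + \lfloor l_{s,p,k} - x_p\rfloor_+\big)\Big].$$ If $R_-^{u,j,k} > 0$, then the solution of the problem of minimizing, over $u_{r,j,k} \in \mathbb{R}$, the function $$R_+^{u,j,k}\exp(u_{s,j,k} + 1 - u_{r,j,k}) + c\,R_-^{u,j,k}\exp(u_{r,j,k} - u_{s,j,k} - 1) - \beta\, u_{r,j,k}$$ is $$u_{r,j,k} = u_{s,j,k} + 1 + \log\left(\frac{\beta + \sqrt{\beta^2 + 4c R_+^{u,j,k} R_-^{u,j,k}}}{2cR_-^{u,j,k}}\right).$$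
   Context: Notation: $\lfloor t \rfloor_+ = \max(t,0)$ for $t\in\mathbb{R}$, and $x_p$ is the $p$-th coordinate of $x \in \mathbb{R}^n$. The numbers $l_{s,p,k}$ and $u_{s,p,k}$ are the boundaries of the smallest axis-parallel box enclosing the $k$-th cluster of positive examples. The set of points used to adjust the upper boundary in dimension $j$ of the $k$-th box is $$X_{u,j,k} := \{x \in \mathbb{R}^n : x_j \geq u_{s,j,k}\} \cup \Big\{x \in \mathbb{R}^n : \tfrac{l_{s,j,k}+u_{s,j,k}}{2} \leq x_j \leq u_{s,j,k},\ l_{s,p,k} \leq x_p \leq u_{s,p,k} \text{ for all } p \neq j\Big\}.$$ The parameter $c$ is the weight given to the majority class. *)

theory Defs
  imports "HOL-Analysis.Analysis"
begin

definition pos_part :: "real \<Rightarrow> real"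
  where "pos_part t = max t 0"

definition lower_bd :: "(real ^ 'n) set \<Rightarrow> 'n \<Rightarrow> real"
  where "lower_bd S p = Min ((\<lambda>x. x $ p) ` S)"

definition upper_bd :: "(real ^ 'n) set \<Rightarrow> 'n \<Rightarrow> real"
  where "upper_bd S p = Max ((\<lambda>x. x $ p) ` S)"

text \<open>Throughout, \<open>Sp\<close> is the set of positive examples in the cluster under consideration,
  \<open>Sm\<close> the set of training examples outside this cluster.\<close>

definition X_upper :: "(real ^ 'n) set \<Rightarrow> 'n \<Rightarrow> (real ^ 'n) set"
  where "X_upper Sp j =
    {x. x $ j \<ge> upper_bd Sp j} \<union>
    {x. (lower_bd Sp j + upper_bd Sp j) / 2 \<le> x $ j \<and> x $ j \<le> upper_bd Sp j \<and>
        (\<forall>p. p \<noteq> j \<longrightarrow> lower_bd Sp p \<le> x $ p \<and> x $ p \<le> upper_bd Sp p)}"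

definition R_plus_upper :: "(real ^ 'n) set \<Rightarrow> 'n \<Rightarrow> real"
  where "R_plus_upper Sp j =
    (\<Sum>x \<in> Sp \<inter> X_upper Sp j. exp (- (upper_bd Sp j - x $ j + 1)))"

definition R_minus_upper :: "(real ^ 'n) set \<Rightarrow> (real ^ 'n) set \<Rightarrow> 'n \<Rightarrow> real"
  where "R_minus_upper Sp Sm j =
    (\<Sum>x \<in> Sm \<inter> X_upper Sp j.
       exp (upper_bd Sp j - x $ j + 1 +
            (\<Sum>p \<in> UNIV - {j}. pos_part (x $ p - upper_bd Sp p) + pos_part (lower_bd Sp p - x $ p))))"

end

theory Submission
  imports Defs
begin

text \<open>With \<open>a\<close> the shift and \<open>s\<close> the positive root of \<open>B s\<^sup>2 - \<beta> s - A = 0\<close>, substituting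
  \<open>u = a + ln s + t\<close> and \<open>\<beta> = B s - A / s\<close> turns the objective, up to an additive constant, into
  \<open>A / s * (exp (- t) - 1 + t) + B s * (exp t - 1 - t)\<close>, which is positive unless \<open>t = 0\<close>.\<close>

text \<open>Equality would give \<open>ln x = x - 1\<close> at \<open>x = exp t\<close>, which
  forces \<open>x = 1\<close> and hence \<open>t = 0\<close>.\<close>

lemma exp_gt_add_one_self:
  fixes t :: real
  assumes "t \<noteq> 0"
  shows "1 + t < exp t"
proof -
  have "exp t \<noteq> 1 + t"
    using ln_eq_minus_one[of "exp t"] assms by auto
  then show ?thesis using exp_ge_add_one_self[of t] by linarith
qed

lemma is_arg_min_exp_combination_iff:
  fixes A B \<beta> a u :: real
  assumes A: "A > 0" and B: "B > 0"
  shows "is_arg_min (\<lambda>u. A * exp (a - u) + B * exp (u - a) - \<beta> * u) (\<lambda>u. True) u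
    \<longleftrightarrow> u = a + ln ((\<beta> + sqrt (\<beta>\<^sup>2 + 4 * A * B)) / (2 * B))"
proof -
  define s where "s = (\<beta> + sqrt (\<beta>\<^sup>2 + 4 * A * B)) / (2 * B)"
  define f where "f = (\<lambda>u. A * exp (a - u) + B * exp (u - a) - \<beta> * u)"
  have AB: "A * B > 0" using A B by simp
  \<comment> \<open>Bounding the absolute value makes the numerator of \<open>s\<close> positive for
    either sign of \<beta>.\<close>
  have "\<bar>\<beta>\<bar> < sqrt (\<beta>\<^sup>2 + 4 * A * B)"
    using AB by (intro real_less_rsqrt) simp
  then have s: "s > 0" unfolding s_def using B by simp
  have "(2 * B * s - \<beta>)\<^sup>2 = \<beta>\<^sup>2 + 4 * A * B"
    unfolding s_def using B AB by simp
  then have "4 * B * (B * s\<^sup>2 - \<beta> * s - A) = 0"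
    by (simp add: power2_eq_square algebra_simps)
  then have "B * s\<^sup>2 - \<beta> * s - A = 0" using B by simp
  then have \<beta>: "\<beta> = B * s - A / s"
    using s by (simp add: field_simps power2_eq_square)
  \<comment> \<open>The linear terms of the two brackets add up to
    \<open>(A / s - B * s) * t\<close>, which is \<open>- \<beta> * t\<close>.\<close>
  have diff: "f (a + ln s + t) - f (a + ln s)
      = A / s * (exp (- t) - (1 + - t)) + B * s * (exp t - (1 + t))" for t
    unfolding f_def \<beta> using s
    by (simp add: exp_add exp_diff exp_minus field_simps)
  have strict: "f (a + ln s) < f v" if "v \<noteq> a + ln s" for v
  proof -
    define t where "t = v - (a + ln s)"
    have "t \<noteq> 0" using that by (simp add: t_def)
    then have "0 < A / s * (exp (- t) - (1 + - t)) + B * s * (exp t - (1 + t))"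
      using exp_gt_add_one_self[of t] exp_gt_add_one_self[of "- t"] A B s
      by (intro add_pos_pos mult_pos_pos) auto
    then show ?thesis using diff[of t] by (simp add: t_def)
  qed
  have "is_arg_min f (\<lambda>u. True) u \<longleftrightarrow> u = a + ln s"
    using strict unfolding is_arg_min_def by (metis order_less_asym)
  then show ?thesis unfolding f_def s_def .
qed

text \<open>An example attaining the maximum in coordinate \<open>j\<close> lies in
  \<open>X_upper S j\<close>, so the sum of exponentials is nonempty. This supplies
  \<open>A > 0\<close>; with \<open>A = 0\<close> and \<beta> \<le> 0 there would be no
  minimiser.\<close>

lemma R_plus_upper_pos:
  fixes S :: "(real ^ 'n) set"
  assumes "finite S" and "S \<noteq> {}"
  shows "R_plus_upper S j > 0"
proof -
  have "upper_bd S j \<in> (\<lambda>x. x $ j) ` S"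
    unfolding upper_bd_def using assms by (intro Max_in) auto
  then obtain x where "x \<in> S" "x $ j = upper_bd S j" by auto
  then have "x \<in> S \<inter> X_upper S j" by (simp add: X_upper_def)
  then show ?thesis
    unfolding R_plus_upper_def using assms(1) by (intro sum_pos) auto
qed

theorem proposition2:
  fixes Sp Sm :: "(real ^ 'n) set" and j :: 'n and c \<beta> u :: real
  assumes "finite Sp" and "Sp \<noteq> {}" and "finite Sm"
    and "0 < c" and "c < 1"
    and "R_minus_upper Sp Sm j > 0"
  shows "is_arg_min
           (\<lambda>u. R_plus_upper Sp j * exp (upper_bd Sp j + 1 - u)
                + c * R_minus_upper Sp Sm j * exp (u - upper_bd Sp j - 1) - \<beta> * u)
           (\<lambda>u. True) u
         \<longleftrightarrow> u = upper_bd Sp j + 1 +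
               ln ((\<beta> + sqrt (\<beta>\<^sup>2 + 4 * c * R_plus_upper Sp j * R_minus_upper Sp Sm j))
                   / (2 * c * R_minus_upper Sp Sm j))"
  using is_arg_min_exp_combination_iff[of "R_plus_upper Sp j" "c * R_minus_upper Sp Sm j"
      "upper_bd Sp j + 1" \<beta> u] R_plus_upper_pos[OF assms(1,2)] assms(4,6)
  by (simp add: diff_diff_eq mult_ac)

end
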